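(* Let $k \geq 3$ and $n \geq 2$ be integers, and let $\alpha_k$ be a positive real number such that $$(k-1)^{\alpha_k} > e(2\alpha_k + 1).$$ Then the girth of any $k$-regular subgraph (not necessarily induced) of the $n$-dimensional grid is at most $2\alpha_k n$.
   Context: The $n$-dimensional grid is the graph with vertex set $\mathbb{Z}^n$ in which two points are adjacent if and only if their Euclidean distance is $1$. A graph is $k$-regular if every vertex has exactly $k$ neighbours; the null graph (with no vertices) is not considered a $k$-regular graph. Regular subgraphs may be infinite. The girth of a graph is the length of its shortest cycle (infinite if there is no cycle). Here $e$ is the base of the natural logarithm. *)

theory Defs
  imports "HOL-Analysis.Analysis" "Graph_Theory.Digraph_Component"
begin

text \<open>
  As in the library, an undirected graph is a symmetric digraph: every edge is represented by
  two opposite arcs. Arcs are pairs of vertices, so there are no parallel edges.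
\<close>

definition real_vec :: "int ^ 'n \<Rightarrow> real ^ 'n" where
  "real_vec x = (\<chi> i. real_of_int (x $ i))"

definition grid :: "(int ^ 'n) pair_pre_digraph" where
  "grid = \<lparr> pverts = UNIV, parcs = {(x, y). dist (real_vec x) (real_vec y) = 1} \<rparr>"

lemma pair_sym_digraph_grid: "pair_sym_digraph grid"
  by unfold_locales (auto simp: grid_def symmetric_def sym_def dist_commute)

lemma pair_loopfree_digraph_grid: "pair_loopfree_digraph grid"
  by unfold_locales (auto simp: grid_def)

definition regular :: "nat \<Rightarrow> ('a, 'b) pre_digraph \<Rightarrow> bool" where
  "regular k G \<longleftrightarrow> verts G \<noteq> {} \<and>
     (\<forall>v\<in>verts G. finite {w. v \<rightarrow>\<^bsub>G\<^esub> w} \<and> card {w. v \<rightarrow>\<^bsub>G\<^esub> w} = k)"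

text \<open>
  The library's \<^const>\<open>pre_digraph.cycle\<close> also accepts the closed walk that runs along an edge
  and back, which is not a cycle of the undirected graph; the length condition excludes it.
  The infimum of the empty set is \<open>\<infinity>\<close>.
\<close>

definition girth :: "('a, 'b) pre_digraph \<Rightarrow> enat" where
  "girth G = (INF p \<in> {p. pre_digraph.cycle G p \<and> 3 \<le> length p}. enat (length p))"

end

theory Submission
  imports Defs
begin

text \<open>
  Put \<open>q = k - 1\<close>, \<open>r = \<lfloor>\<alpha> n\<rfloor>\<close> and suppose that the girth exceeds \<open>2 \<alpha> n \<ge> 2 r\<close>. Then
  non-backtracking walks of length at most \<open>r\<close> from a fixed vertex have distinct ends, so that the
  ball of radius \<open>r\<close> in \<open>H\<close> has at least \<open>q\<^sup>r\<^sup>+\<^sup>1 / (q - 1)\<close> vertices. It lies in an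
  \<open>\<ell>\<^sub>1\<close>-ball of the grid, which has at most
  \<open>(2 r + n choose n) \<le> (2 r + (n + 1) / 2)\<^sup>n / n!\<close> points. Since the hypothesis on \<open>\<alpha>\<close> persists for
  larger values, in particular for \<open>(r + 1) / n\<close>, also \<open>q\<^sup>r\<^sup>+\<^sup>1 > (e (2 r + 2 + n) / n)\<^sup>n\<close>.
  The two estimates contradict each other as soon as
  \<open>q - 1 \<le> (e\<^sup>n n! / n\<^sup>n) ((2 r + 2 + n) / (2 r + (n + 1) / 2))\<^sup>n\<close>. Here \<open>q < 2 n\<close>. For \<open>q \<le> 6\<close> the
  first factor suffices, since it increases with \<open>n\<close>. For \<open>q \<ge> 7\<close> the lower and upper bounds for the
  ball force \<open>r \<le> n\<close>, and then the second factor is at least \<open>(6 / 5)\<^sup>n\<close>.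
\<close>

section \<open>Non-backtracking walks and cycles\<close>

text \<open>Walks are lists of vertices, so a walk with \<open>j\<close> steps has length
  \<open>j + 1\<close>. The empty list is excluded so that \<open>hd\<close> and \<open>last\<close>
  always are the ends of the walk.\<close>

fun nonbacktracking :: "'a rel \<Rightarrow> 'a list \<Rightarrow> bool" where
  "nonbacktracking E [] \<longleftrightarrow> False"
| "nonbacktracking E [x] \<longleftrightarrow> True"
| "nonbacktracking E (x # y # zs) \<longleftrightarrow>
     (x, y) \<in> E \<and> (zs = [] \<or> hd zs \<noteq> x) \<and> nonbacktracking E (y # zs)"

lemma nonbacktracking_prefix:
  "nonbacktracking E (p @ q) \<Longrightarrow> p \<noteq> [] \<Longrightarrow> nonbacktracking E p"
proof (induction E p rule: nonbacktracking.induct)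
  case (3 E x y zs)
  then show ?case by (cases zs) auto
qed auto

text \<open>Reversing one walk and continuing with the other can backtrack only at the junction
  \<open>x\<close>, and there the two neighbours differ. The induction moves the vertices of
  \<open>p\<close> one by one to the front of the second walk.\<close>

lemma nonbacktracking_rev_append:
  assumes "sym E" "nonbacktracking E (x # p)" "nonbacktracking E (x # q)"
    and "p = [] \<or> q = [] \<or> hd p \<noteq> hd q"
  shows "nonbacktracking E (rev p @ x # q)"
  using assms(2-)
proof (induction p arbitrary: x q)
  case (Cons y p)
  have "nonbacktracking E (y # x # q)"
    using Cons.prems symD[OF assms(1)] by auto
  moreover have "nonbacktracking E (y # p)" "p = [] \<or> hd p \<noteq> x"
    using Cons.prems by auto
  ultimately have "nonbacktracking E (rev p @ y # x # q)"
    by (intro Cons.IH) auto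
  then show ?case by simp
qed simp

lemma nonbacktracking_arcs:
  "nonbacktracking E p \<Longrightarrow> set (zip p (tl p)) \<subseteq> E"
  by (induction E p rule: nonbacktracking.induct) auto

lemma pawalk_verts_zip_tl: "p \<noteq> [] \<Longrightarrow> pawalk_verts (hd p) (zip p (tl p)) = p"
proof (induction p)
  case (Cons x p)
  then show ?case by (cases p) auto
qed simp

lemma pcas_zip_tl: "p \<noteq> [] \<Longrightarrow> pcas (hd p) (zip p (tl p)) (last p)"
proof (induction p)
  case (Cons x p)
  then show ?case by (cases p) auto
qed simp

text \<open>In the shortest suffix with a repeated vertex only the first vertex \<open>x\<close>
  recurs, so the segment up to its next occurrence is a cycle. Cycles are lists of arcs, one fewer
  than the vertices traversed, whence the strict bound on the length.\<close>

lemma ex_cycle_of_nonbacktracking: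
  assumes "pair_loopfree_digraph H" "nonbacktracking (parcs H) p" "\<not> distinct p"
  shows "\<exists>c. pre_digraph.cycle (with_proj H) c \<and> 3 \<le> length c \<and> length c < length p"
  using assms(2,3)
proof (induction p)
  case (Cons x p)
  interpret pair_loopfree_digraph H by (rule assms(1))
  show ?case
  proof (cases "distinct p")
    case False
    moreover from this have "nonbacktracking (parcs H) p"
      using Cons.prems by (cases p) auto
    ultimately show ?thesis using Cons.IH by force
  next
    case True
    then obtain as bs where p: "p = as @ x # bs" and x: "x \<notin> set as"
      using Cons.prems by (metis distinct.simps(2) split_list_first)
    define c where "c = x # as @ [x]"
    have nb: "nonbacktracking (parcs H) c"
      using Cons.prems(1) nonbacktracking_prefix[of "parcs H" c bs] by (simp add: p c_def)
    \<comment> \<open>An empty \<open>as\<close> would give a loop at \<open>x\<close>, and a single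
      vertex in \<open>as\<close> an edge run along and straight back.\<close>
    have "as \<noteq> []" using nb pair_no_loops[of "(x, x)"] by (auto simp: c_def)
    moreover have "length as \<noteq> 1"
      using nb by (auto simp: c_def length_Suc_conv)
    ultimately have len: "length as \<ge> 2" by (cases as) (auto simp: Suc_le_eq)
    have "awalk x (zip c (tl c)) x"
    proof -
      have "(x, hd as) \<in> parcs H" using nb \<open>as \<noteq> []\<close> by (cases as) (auto simp: c_def)
      then show ?thesis
        using nonbacktracking_arcs[OF nb] pcas_zip_tl[of c] in_arcsD1
        by (auto simp: awalk_def c_def)
    qed
    moreover have "distinct (tl (pawalk_verts x (zip c (tl c))))"
      using pawalk_verts_zip_tl[of c] True x p by (simp add: c_def)
    moreover have "zip c (tl c) \<noteq> []" by (simp add: c_def zip_eq_Nil_iff)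
    ultimately have "cycle (zip c (tl c))" by (auto simp: cycle_def)
    then show ?thesis using len by (intro exI[of _ "zip c (tl c)"]) (auto simp: c_def p)
  qed
qed simp

text \<open>Two different walks with the same ends close up, once their common initial part has been
  removed, to a non-backtracking closed walk.\<close>

lemma nonbacktracking_unique:
  assumes "pair_loopfree_digraph H" "sym (parcs H)"
    and no_cycle: "\<And>c. pre_digraph.cycle (with_proj H) c \<Longrightarrow> 3 \<le> length c \<Longrightarrow> 2 * r < length c"
    and "nonbacktracking (parcs H) p" "length p \<le> Suc r"
    and "nonbacktracking (parcs H) q" "length q \<le> Suc r"
    and "hd p = hd q" "last p = last q"
  shows "p = q"
  using assms(4-)
proof (induction p arbitrary: q)
  case (Cons x p)
  then obtain q' where q: "q = x # q'" by (cases q) auto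
  have "p = q'"
  proof (cases "p \<noteq> [] \<and> q' \<noteq> [] \<and> hd p = hd q'")
    case True
    moreover have "nonbacktracking (parcs H) p" "nonbacktracking (parcs H) q'"
      using Cons.prems(1,3) True q by (cases p; cases q'; simp)+
    ultimately show ?thesis using Cons.prems q by (intro Cons.IH) auto
  next
    case False
    show ?thesis
    proof (rule ccontr)
      assume ne: "p \<noteq> q'"
      have "nonbacktracking (parcs H) (rev p @ x # q')"
        using False Cons.prems q assms(2) by (intro nonbacktracking_rev_append) auto
      moreover have "\<not> distinct (rev p @ x # q')"
        using Cons.prems(6) ne unfolding q
        by (cases "p = []"; cases "q' = []") (auto dest: last_in_set)
      \<comment> \<open>The closed walk has at most \<open>2 * r + 1\<close> vertices, so the cycle
        in it has at most \<open>2 * r\<close> arcs.\<close>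
      ultimately obtain c where "pre_digraph.cycle (with_proj H) c" "3 \<le> length c"
        "length c < length (rev p @ x # q')"
        using ex_cycle_of_nonbacktracking[OF assms(1)] by blast
      with no_cycle[of c] Cons.prems q show False by auto
    qed
  qed
  then show ?case by (simp add: q)
qed simp

section \<open>Counting walks: the Moore bound\<close>

text \<open>Walks are extended at the front, so the list starts at the end of the walk.\<close>

definition nonbacktracking_to :: "'a rel \<Rightarrow> 'a \<Rightarrow> nat \<Rightarrow> 'a list set" where
  "nonbacktracking_to E v j = {p. nonbacktracking E p \<and> last p = v \<and> length p = Suc j}"

lemma nonbacktracking_to_0: "nonbacktracking_to E v 0 = {[v]}"
  by (auto simp: nonbacktracking_to_def length_Suc_conv)

text \<open>The set \<open>set (take 1 (tl p))\<close> contains the second vertex of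
  \<open>p\<close>, the only one that must not be prepended; it is empty for a walk without
  steps.\<close>

lemma nonbacktracking_to_Suc:
  "nonbacktracking_to E v (Suc j) =
     (\<Union>p\<in>nonbacktracking_to E v j. (\<lambda>x. x # p) ` ({x. (x, hd p) \<in> E} - set (take 1 (tl p))))"
  (is "_ = ?R")
proof (intro equalityI subsetI)
  fix p assume "p \<in> nonbacktracking_to E v (Suc j)"
  then obtain x y zs where p: "p = x # y # zs" and "nonbacktracking E p" "last p = v"
    "length p = Suc (Suc j)"
    by (auto simp: nonbacktracking_to_def length_Suc_conv)
  then have "y # zs \<in> nonbacktracking_to E v j" "(x, y) \<in> E" "x \<notin> set (take 1 zs)"
    by (cases zs; auto simp: nonbacktracking_to_def)+
  then show "p \<in> ?R" by (auto simp: p intro!: bexI[of _ "y # zs"])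
next
  fix p assume "p \<in> ?R"
  then obtain x q where "p = x # q" "q \<in> nonbacktracking_to E v j" "(x, hd q) \<in> E"
    "x \<notin> set (take 1 (tl q))" by blast
  then show "p \<in> nonbacktracking_to E v (Suc j)"
    by (cases q; cases "tl q") (auto simp: nonbacktracking_to_def)
qed

lemma nonbacktracking_hd_in:
  "nonbacktracking E p \<Longrightarrow> E \<subseteq> V \<times> V \<Longrightarrow> last p \<in> V \<Longrightarrow> hd p \<in> V"
  by (cases "(E, p)" rule: nonbacktracking.cases) auto

text \<open>The first step may go to any of the \<open>Suc q\<close> neighbours, every later one to
  all but the vertex just left.\<close>

lemma card_nonbacktracking_to:
  assumes "sym E" "E \<subseteq> V \<times> V" "v \<in> V"
    and deg: "\<And>u. u \<in> V \<Longrightarrow> finite {w. (u, w) \<in> E} \<and> card {w. (u, w) \<in> E} = Suc q"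
  shows "finite (nonbacktracking_to E v (Suc j)) \<and> card (nonbacktracking_to E v (Suc j)) = Suc q * q ^ j"
proof -
  have nbrs: "{x. (x, u) \<in> E} = {w. (u, w) \<in> E}" for u
    using symD[OF assms(1)] by auto
  show ?thesis
  proof (induction j)
    case 0
    then show ?case
      using deg[OF assms(3)]
      by (simp add: nonbacktracking_to_Suc nonbacktracking_to_0 nbrs card_image inj_on_def)
  next
    case (Suc j)
    define N where "N p = {x. (x, hd p) \<in> E} - set (take 1 (tl p))" for p
    have N: "finite (N p) \<and> card (N p) = q" if p: "p \<in> nonbacktracking_to E v (Suc j)" for p
    proof -
      obtain x y zs where p_eq: "p = x # y # zs"
        using p by (auto simp: nonbacktracking_to_def length_Suc_conv)
      have "(x, y) \<in> E" "x \<in> V"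
        using p nonbacktracking_hd_in[of E p V] assms by (auto simp: p_eq nonbacktracking_to_def)
      then show ?thesis using deg[of x] by (simp add: N_def p_eq nbrs)
    qed
    have eq: "nonbacktracking_to E v (Suc (Suc j)) =
        (\<Union>p\<in>nonbacktracking_to E v (Suc j). (\<lambda>x. x # p) ` N p)"
      unfolding nonbacktracking_to_Suc[of E v "Suc j"] N_def ..
    have "card (nonbacktracking_to E v (Suc (Suc j))) =
        (\<Sum>p\<in>nonbacktracking_to E v (Suc j). card ((\<lambda>x. x # p) ` N p))"
      unfolding eq using Suc N by (intro card_UN_disjoint) auto
    also have "\<dots> = (\<Sum>p\<in>nonbacktracking_to E v (Suc j). q)"
      using N by (intro sum.cong) (auto simp: card_image inj_on_def)
    finally show ?case using Suc N by (auto simp: eq algebra_simps)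
  qed
qed

text \<open>By \<open>nonbacktracking_unique\<close> a walk with at most \<open>r\<close> steps
  ending in \<open>v\<close> is determined by its other end \<open>hd p\<close>, so \<open>B\<close>
  has at least as many elements as there are such walks.\<close>

lemma moore_bound:
  fixes q r :: nat
  assumes "pair_loopfree_digraph H" "sym (parcs H)" "v \<in> pverts H"
    and deg: "\<And>u. u \<in> pverts H \<Longrightarrow> finite {w. (u, w) \<in> parcs H} \<and> card {w. (u, w) \<in> parcs H} = Suc q"
    and no_cycle: "\<And>c. pre_digraph.cycle (with_proj H) c \<Longrightarrow> 3 \<le> length c \<Longrightarrow> 2 * r < length c"
    and B: "finite B" "\<And>p. nonbacktracking (parcs H) p \<Longrightarrow> last p = v \<Longrightarrow> length p \<le> Suc r \<Longrightarrow> hd p \<in> B"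
    and "q \<ge> 2" "r \<ge> 1"
  shows "q ^ Suc r \<le> (q - 1) * card B"
proof -
  interpret pair_loopfree_digraph H by (rule assms(1))
  let ?W = "nonbacktracking_to (parcs H) v"
  have W: "finite (?W (Suc j)) \<and> card (?W (Suc j)) = Suc q * q ^ j" for j
    using in_arcsD1 in_arcsD2 assms(2,3) deg by (intro card_nonbacktracking_to[of _ "pverts H"]) auto
  have fin: "finite (?W j)" for j
    using W by (cases j) (auto simp: nonbacktracking_to_0)
  have "card (\<Union>j\<in>{..r}. ?W j) = (\<Sum>j\<le>r. card (?W j))"
    using fin by (intro card_UN_disjoint) (auto simp: nonbacktracking_to_def)
  moreover have "card (\<Union>j\<in>{..r}. ?W j) \<le> card B"
  proof (rule card_inj_on_le[where f = hd])
    show "inj_on hd (\<Union>j\<in>{..r}. ?W j)"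
      using nonbacktracking_unique[OF assms(1,2) no_cycle]
      by (intro inj_onI) (auto simp: nonbacktracking_to_def)
  qed (use B in \<open>auto simp: nonbacktracking_to_def\<close>)
  \<comment> \<open>This is the geometric series for the number of walks, with the denominator
    \<open>q - 1\<close> cleared.\<close>
  moreover have "(q - 1) * (\<Sum>j\<le>r. card (?W j)) + 2 = Suc q * q ^ r" for r
  proof (induction r)
    case (Suc r)
    have "(q - 1) * (\<Sum>j\<le>Suc r. card (?W j)) + 2 = Suc q * q ^ r + (q - 1) * (Suc q * q ^ r)"
      using Suc W by (simp add: distrib_left)
    also have "\<dots> = (1 + (q - 1)) * (Suc q * q ^ r)"
      by (simp only: distrib_right mult_1)
    also have "\<dots> = Suc q * q ^ Suc r" using \<open>q \<ge> 2\<close> by (simp add: algebra_simps)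
    finally show ?case .
  qed (use \<open>q \<ge> 2\<close> in \<open>simp add: nonbacktracking_to_0\<close>)
  ultimately have "Suc q * q ^ r \<le> (q - 1) * card B + 2"
    by (metis add_le_mono1 mult_le_mono2)
  \<comment> \<open>Since \<open>Suc q * q ^ r = q ^ Suc r + q ^ r\<close>, the last summand absorbs
    the 2.\<close>
  moreover have "q ^ r \<ge> 2"
    using \<open>q \<ge> 2\<close> self_le_power[of q r] \<open>r \<ge> 1\<close> by linarith
  ultimately show ?thesis by simp
qed

section \<open>Lattice points in l1-balls\<close>

text \<open>Forcing the value 0 outside \<open>I\<close> represents each point indexed by
  \<open>I\<close> by exactly one function, which permits induction on \<open>I\<close>.\<close>

definition l1_ball :: "'i set \<Rightarrow> nat \<Rightarrow> ('i \<Rightarrow> int) set" where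
  "l1_ball I r = {f. (\<forall>i. i \<notin> I \<longrightarrow> f i = 0) \<and> (\<Sum>i\<in>I. \<bar>f i\<bar>) \<le> int r}"

lemma l1_ball_insert:
  assumes "finite I" "i \<notin> I"
  shows "l1_ball (insert i I) r \<subseteq>
    (\<Union>j\<in>{- int r..int r}. (\<lambda>f. f(i := j)) ` l1_ball I (nat (int r - \<bar>j\<bar>)))"
proof
  fix f assume f: "f \<in> l1_ball (insert i I) r"
  have le: "\<bar>f i\<bar> + (\<Sum>l\<in>I. \<bar>f l\<bar>) \<le> int r" using f assms by (simp add: l1_ball_def)
  have eq: "(\<Sum>l\<in>I. \<bar>(f(i := 0)) l\<bar>) = (\<Sum>l\<in>I. \<bar>f l\<bar>)"
    using assms by (intro sum.cong) auto
  have nn: "(\<Sum>l\<in>I. \<bar>f l\<bar>) \<ge> 0" by (rule sum_nonneg) auto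
  have "f(i := 0) \<in> l1_ball I (nat (int r - \<bar>f i\<bar>))"
    using f le nn unfolding l1_ball_def eq mem_Collect_eq by auto
  moreover have "f = (f(i := 0))(i := f i)" by auto
  moreover have "f i \<in> {- int r..int r}" using le nn unfolding atLeastAtMost_iff by linarith
  ultimately show "f \<in> (\<Union>j\<in>{- int r..int r}. (\<lambda>f. f(i := j)) ` l1_ball I (nat (int r - \<bar>j\<bar>)))"
    by blast
qed

lemma sum_abs_interval:
  fixes g :: "nat \<Rightarrow> nat"
  shows "(\<Sum>j\<in>{- int r..int r}. g (nat (int r - \<bar>j\<bar>))) = g r + 2 * (\<Sum>i<r. g i)"
proof -
  \<comment> \<open>The nonzero \<open>j\<close> are parametrised by the remaining radius
    \<open>i = r - \<bar>j\<bar>\<close>, once for each sign.\<close>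
  have eq: "{- int r..int r} = insert 0 ((\<lambda>i. int (r - i)) ` {..<r} \<union> (\<lambda>i. - int (r - i)) ` {..<r})"
    (is "_ = insert 0 (?A \<union> ?B)")
  proof (intro equalityI subsetI)
    fix j assume j: "j \<in> {- int r..int r}"
    consider "j = 0" | "j > 0" | "j < 0" by linarith
    then show "j \<in> insert 0 (?A \<union> ?B)"
    proof cases
      case 2
      then have "j = int (r - nat (int r - j))" "nat (int r - j) < r" using j by auto
      then show ?thesis by blast
    next
      case 3
      then have "j = - int (r - nat (int r + j))" "nat (int r + j) < r" using j by auto
      then show ?thesis by blast
    qed auto
  qed auto
  have "(\<Sum>j\<in>{- int r..int r}. g (nat (int r - \<bar>j\<bar>))) =
      g r + ((\<Sum>j\<in>?A. g (nat (int r - \<bar>j\<bar>))) + (\<Sum>j\<in>?B. g (nat (int r - \<bar>j\<bar>))))"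
    unfolding eq by (subst sum.insert; (subst sum.union_disjoint)?) auto
  also have "(\<Sum>j\<in>?A. g (nat (int r - \<bar>j\<bar>))) = (\<Sum>i<r. g i)"
    by (subst sum.reindex) (auto simp: inj_on_def intro!: sum.cong arg_cong[of _ _ g])
  also have "(\<Sum>j\<in>?B. g (nat (int r - \<bar>j\<bar>))) = (\<Sum>i<r. g i)"
    by (subst sum.reindex) (auto simp: inj_on_def intro!: sum.cong arg_cong[of _ _ g])
  finally show ?thesis by simp
qed

text \<open>Slicing by one coordinate reduces the bound to an inequality of hockey-stick type for
  binomial coefficients.\<close>

lemma card_l1_ball_le:
  assumes "finite I"
  shows "finite (l1_ball I r) \<and> card (l1_ball I r) \<le> (2 * r + card I) choose card I"
  using assms
proof (induction I arbitrary: r rule: finite_induct)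
  case empty
  have "l1_ball ({} :: 'a set) r = {\<lambda>_. 0}" by (auto simp: l1_ball_def)
  then show ?case by simp
next
  case (insert i I)
  let ?n = "card I"
  let ?U = "\<lambda>j. (\<lambda>f. f(i := j)) ` l1_ball I (nat (int r - \<bar>j\<bar>))"
  have fin: "finite (\<Union>j\<in>{- int r..int r}. ?U j)" using insert.IH by auto
  note sub = l1_ball_insert[OF insert.hyps, of r]
  have "card (l1_ball (insert i I) r) \<le> card (\<Union>j\<in>{- int r..int r}. ?U j)"
    by (rule card_mono[OF fin sub])
  also have "\<dots> \<le> (\<Sum>j\<in>{- int r..int r}. card (?U j))"
    by (rule card_UN_le) simp
  also have "\<dots> \<le> (\<Sum>j\<in>{- int r..int r}. (2 * nat (int r - \<bar>j\<bar>) + ?n) choose ?n)"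
    using insert.IH by (intro sum_mono order_trans[OF card_image_le]) auto
  also have "\<dots> = ((2 * r + ?n) choose ?n) + 2 * (\<Sum>i<r. (2 * i + ?n) choose ?n)"
    by (rule sum_abs_interval[of "\<lambda>i. (2 * i + ?n) choose ?n"])
  also have "\<dots> \<le> (2 * r + Suc ?n) choose Suc ?n"
  proof (induction r)
    case (Suc r)
    \<comment> \<open>When \<open>r\<close> grows by one, the left side gains
      \<open>(2 * r + 2 + ?n) choose ?n\<close> and \<open>(2 * r + ?n) choose ?n\<close>. Pascal's
      rule, applied twice, gives the right side the same first term and
      \<open>(2 * r + 1 + ?n) choose ?n\<close>.\<close>
    have "((2 * r + ?n) choose ?n) \<le> (Suc (2 * r + ?n)) choose ?n"
      by (rule binomial_right_mono) simp
    with Suc show ?case by simp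
  qed simp
  finally show ?case
    using finite_subset[OF sub fin] insert.hyps by simp
qed

section \<open>The l1-metric on the grid\<close>

definition l1_dist :: "int ^ 'n \<Rightarrow> int ^ 'n \<Rightarrow> int" where
  "l1_dist x y = (\<Sum>i\<in>UNIV. \<bar>x $ i - y $ i\<bar>)"

lemma l1_dist_triangle: "l1_dist x z \<le> l1_dist x y + l1_dist y z"
  unfolding l1_dist_def sum.distrib[symmetric] by (intro sum_mono) auto

lemma card_l1_dist_ball_le:
  fixes v :: "int ^ 'n"
  shows "finite {x. l1_dist x v \<le> int r}"
    and "card {x. l1_dist x v \<le> int r} \<le> (2 * r + CARD('n)) choose CARD('n)"
proof -
  let ?f = "\<lambda>(x :: int ^ 'n) i. x $ i - v $ i"
  have inj: "inj_on ?f A" for A by (intro inj_onI) (simp add: fun_eq_iff vec_eq_iff)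
  have sub: "?f ` {x. l1_dist x v \<le> int r} \<subseteq> l1_ball UNIV r"
    by (auto simp: l1_dist_def l1_ball_def)
  have fin: "finite (l1_ball (UNIV :: 'n set) r)"
    "card (l1_ball (UNIV :: 'n set) r) \<le> (2 * r + CARD('n)) choose CARD('n)"
    using card_l1_ball_le[of "UNIV :: 'n set" r] by auto
  show "finite {x. l1_dist x v \<le> int r}"
    using inj_on_finite[OF inj sub fin(1)] .
  show "card {x. l1_dist x v \<le> int r} \<le> (2 * r + CARD('n)) choose CARD('n)"
    using card_inj_on_le[OF inj sub fin(1)] fin(2) by (rule order_trans)
qed

lemma grid_arc_iff:
  fixes x y :: "int ^ 'n"
  shows "(x, y) \<in> parcs grid \<longleftrightarrow> (\<Sum>i\<in>UNIV. (x $ i - y $ i)\<^sup>2) = 1"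
proof -
  have "(x, y) \<in> parcs grid \<longleftrightarrow> (\<Sum>i\<in>UNIV. (real_of_int (x $ i) - real_of_int (y $ i))\<^sup>2) = 1"
    by (simp add: grid_def dist_vec_def real_vec_def L2_set_def dist_real_def)
  also have "\<dots> \<longleftrightarrow> real_of_int (\<Sum>i\<in>UNIV. (x $ i - y $ i)\<^sup>2) = 1" by simp
  finally show ?thesis by linarith
qed

lemma l1_dist_grid_arc:
  assumes "(x, y) \<in> parcs grid"
  shows "l1_dist x y \<le> 1"
proof -
  have "\<bar>a\<bar> \<le> a\<^sup>2" for a :: int
  proof (cases "a = 0")
    case False
    then have "\<bar>a\<bar> * 1 \<le> \<bar>a\<bar> * \<bar>a\<bar>" by (intro mult_left_mono) auto
    then show ?thesis by (simp add: power2_eq_square)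
  qed simp
  then have "l1_dist x y \<le> (\<Sum>i\<in>UNIV. (x $ i - y $ i)\<^sup>2)"
    unfolding l1_dist_def by (intro sum_mono)
  with assms show ?thesis by (simp add: grid_arc_iff)
qed

lemma card_grid_neighbours_le:
  fixes v :: "int ^ 'n"
  shows "finite {w. (v, w) \<in> parcs grid}" and "card {w. (v, w) \<in> parcs grid} \<le> 2 * CARD('n)"
proof -
  let ?f = "\<lambda>(i, c). v + axis i c" and ?A = "(UNIV :: 'n set) \<times> {1, -1 :: int}"
  have sub: "{w. (v, w) \<in> parcs grid} \<subseteq> ?f ` ?A"
  proof safe
    fix w assume "(v, w) \<in> parcs grid"
    then have sum: "(\<Sum>i\<in>UNIV. (v $ i - w $ i)\<^sup>2) = 1" by (simp add: grid_arc_iff)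
    then obtain i where i: "v $ i \<noteq> w $ i" by fastforce
    have split: "(v $ i - w $ i)\<^sup>2 + (\<Sum>j\<in>UNIV - {i}. (v $ j - w $ j)\<^sup>2) = 1"
      using sum by (simp add: sum.remove[of UNIV i])
    have "(v $ i - w $ i)\<^sup>2 > 0" using i by simp
    moreover have "(\<Sum>j\<in>UNIV - {i}. (v $ j - w $ j)\<^sup>2) \<ge> 0" by (rule sum_nonneg) simp
    \<comment> \<open>A positive integer square is at least 1, so it exhausts the whole sum and the
      other coordinates agree.\<close>
    ultimately have one: "(w $ i - v $ i)\<^sup>2 = 1" and zero: "(\<Sum>j\<in>UNIV - {i}. (v $ j - w $ j)\<^sup>2) = 0"
      using split power2_commute[of "v $ i" "w $ i"] by linarith+
    from zero have "v $ j = w $ j" if "j \<noteq> i" for j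
      using that by (subst (asm) sum_nonneg_eq_0_iff) auto
    then have "w = v + axis i (w $ i - v $ i)" by (auto simp: vec_eq_iff axis_def)
    moreover have "w $ i - v $ i \<in> {1, -1}" using one by (auto simp: power2_eq_1_iff)
    ultimately show "w \<in> ?f ` ?A" by (intro image_eqI[of _ _ "(i, w $ i - v $ i)"]) auto
  qed
  show "finite {w. (v, w) \<in> parcs grid}" by (rule finite_subset[OF sub]) simp
  have "card {w. (v, w) \<in> parcs grid} \<le> card (?f ` ?A)" by (rule card_mono[OF _ sub]) simp
  also have "\<dots> \<le> card ?A" by (rule card_image_le) simp
  also have "\<dots> = 2 * CARD('n)" by (simp add: card_cartesian_product)
  finally show "card {w. (v, w) \<in> parcs grid} \<le> 2 * CARD('n)" .
qed

text \<open>Each step has l1-length at most 1; the inequality is strict because there is one more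
  vertex than steps.\<close>

lemma l1_dist_nonbacktracking:
  assumes "E \<subseteq> parcs grid" "nonbacktracking E p"
  shows "l1_dist (hd p) (last p) < int (length p)"
  using assms(2)
proof (induction p)
  case (Cons x p)
  show ?case
  proof (cases p)
    case (Cons y zs)
    then have "(x, y) \<in> parcs grid" "nonbacktracking E p"
      using Cons.prems assms(1) by auto
    then show ?thesis
      using Cons.IH l1_dist_grid_arc[of x y] l1_dist_triangle[of x "last p" y] Cons by simp
  qed (simp add: l1_dist_def)
qed simp

section \<open>Persistence of the hypothesis for larger exponents\<close>

text \<open>The hypothesis forces \<open>\<alpha> * ln q > 1\<close>, hence
  \<open>ln q \<ge> 2 / (2 * \<alpha> + 1)\<close>. So from \<alpha> on, the logarithm of the right
  side grows at least as fast as that of the left side.\<close>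

lemma threshold_mono:
  fixes q \<alpha> \<sigma> :: real
  assumes "q > 1" "\<alpha> > 0" "exp 1 * (2 * \<alpha> + 1) < q powr \<alpha>" "\<alpha> \<le> \<sigma>"
  shows "exp 1 * (2 * \<sigma> + 1) < q powr \<sigma>"
proof -
  have "exp 1 * 1 < exp 1 * (2 * \<alpha> + 1)" using assms(2) by (intro mult_strict_left_mono) auto
  also have "\<dots> < exp (\<alpha> * ln q)" using assms by (simp add: powr_def)
  finally have ln: "1 < \<alpha> * ln q" by simp
  have "2 * \<alpha> * 1 \<le> 2 * \<alpha> * (\<alpha> * ln q)"
    using ln assms(2) by (intro mult_left_mono) auto
  then have "2 * \<alpha> \<le> \<alpha> * ((2 * \<alpha> + 1) * ln q)"
    using ln by (simp add: algebra_simps)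
  then have slope: "2 \<le> (2 * \<alpha> + 1) * ln q" using assms(2) by simp
  have "2 * (\<sigma> - \<alpha>) \<le> (2 * \<alpha> + 1) * ln q * (\<sigma> - \<alpha>)"
    using slope assms(4) by (intro mult_right_mono) auto
  then have "exp 1 * (2 * \<sigma> + 1) \<le> exp 1 * ((2 * \<alpha> + 1) * (1 + (\<sigma> - \<alpha>) * ln q))"
    by (intro mult_left_mono) (auto simp: algebra_simps)
  also have "\<dots> \<le> exp 1 * ((2 * \<alpha> + 1) * exp ((\<sigma> - \<alpha>) * ln q))"
    using assms(2) by (intro mult_left_mono exp_ge_add_one_self) auto
  also have "\<dots> = exp 1 * (2 * \<alpha> + 1) * q powr (\<sigma> - \<alpha>)"
    using assms(1) by (simp add: powr_def)
  also have "\<dots> < q powr \<alpha> * q powr (\<sigma> - \<alpha>)"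
    using assms by (intro mult_strict_right_mono) auto
  also have "\<dots> = q powr \<sigma>" by (simp flip: powr_add)
  finally show ?thesis .
qed

section \<open>Estimates for factorials and binomial coefficients\<close>

text \<open>The sequence \<open>exp n * fact n / n ^ n\<close> increases because
  \<open>(1 + 1 / n) ^ n \<le> exp 1\<close>; a lower bound \<open>c\<close> is therefore inherited
  by the next term.\<close>

lemma pow_self_Suc_le: "real (Suc n) ^ Suc n * c \<le> exp (Suc n) * fact (Suc n)"
  if "real n ^ n * c \<le> exp n * fact n" "n > 0" "c \<ge> 0"
proof -
  have "(1 + 1 / real n) ^ n \<le> exp (1 / real n) ^ n"
    by (intro power_mono exp_ge_add_one_self) auto
  also have "\<dots> = exp 1" using that by (simp flip: exp_of_nat_mult)
  finally have e: "(1 + 1 / real n) ^ n \<le> exp 1" .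
  have "real (Suc n) = real n * (1 + 1 / real n)" using that by (simp add: field_simps)
  then have "real (Suc n) ^ n = real n ^ n * (1 + 1 / real n) ^ n"
    by (simp only: power_mult_distrib)
  then have "real (Suc n) ^ Suc n * c = real (Suc n) * (real n ^ n * c) * (1 + 1 / real n) ^ n"
    by simp
  also have "\<dots> \<le> real (Suc n) * (exp n * fact n) * exp 1"
    by (rule mult_mono[OF mult_left_mono[OF that(1)] e]) auto
  also have "\<dots> = exp (Suc n) * fact (Suc n)"
    by (simp add: exp_add algebra_simps)
  finally show ?thesis .
qed

lemma pow_self_le:
  assumes "real m ^ m * c \<le> exp m * fact m" "m > 0" "c \<ge> 0" "m \<le> n"
  shows "real n ^ n * c \<le> exp n * fact n"
  using assms(4)
proof (induction n rule: dec_induct)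
  case (step n)
  then show ?case using assms by (intro pow_self_Suc_le) auto
qed (rule assms(1))

text \<open>The second decimal matters: the case \<open>n = 4\<close> below needs
  \<open>1280 \<le> 24 * exp 4\<close>, which 2.71 yields and 2.7 does not.\<close>

lemma exp_1_ge: "exp 1 \<ge> (271 / 100 :: real)"
  using e_approx_32 by (simp add: abs_if split: if_splits)

lemma exp_nat_ge: "exp (real m) \<ge> (271 / 100) ^ m"
proof -
  have "(271 / 100) ^ m \<le> (exp 1 :: real) ^ m" by (intro power_mono exp_1_ge) simp
  then show ?thesis by (simp flip: exp_of_nat_mult)
qed

text \<open>The constants bound \<open>q - 1\<close> for \<open>q \<le> 3\<close>,
  \<open>q \<le> 5\<close> and \<open>q = 6\<close>; the ranges of \<open>n\<close> are those left
  by \<open>q + 1 \<le> 2 * n\<close>. The third bound also serves for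
  \<open>q \<ge> 7\<close>.\<close>

lemma pow_self_le_exp_fact:
  shows "n \<ge> 2 \<Longrightarrow> real n ^ n * 2 \<le> exp n * fact n"
    and "n \<ge> 3 \<Longrightarrow> real n ^ n * 4 \<le> exp n * fact n"
    and "n \<ge> 4 \<Longrightarrow> real n ^ n * 5 \<le> exp n * fact n"
proof -
  have "real 2 ^ 2 * 2 \<le> exp (real 2) * fact 2" "real 3 ^ 3 * 4 \<le> exp (real 3) * fact 3"
    "real 4 ^ 4 * 5 \<le> exp (real 4) * fact 4"
    using exp_nat_ge[of 2] exp_nat_ge[of 3] exp_nat_ge[of 4]
    by (simp_all add: fact_numeral power_divide)
  then show "n \<ge> 2 \<Longrightarrow> real n ^ n * 2 \<le> exp n * fact n"
    "n \<ge> 3 \<Longrightarrow> real n ^ n * 4 \<le> exp n * fact n"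
    "n \<ge> 4 \<Longrightarrow> real n ^ n * 5 \<le> exp n * fact n"
    by (auto intro: pow_self_le[of 2] pow_self_le[of 3] pow_self_le[of 4])
qed

text \<open>This is the AM-GM inequality for an arithmetic progression. The first and last factors
  are split off together, which leaves a progression with the same mean.\<close>

lemma pochhammer_le_power:
  fixes a :: real
  assumes "a \<ge> 1"
  shows "pochhammer a n \<le> (a + (real n - 1) / 2) ^ n"
  using assms
proof (induction n arbitrary: a rule: induct_nat_012)
  case (ge2 n)
  let ?m = "a + (real n + 1) / 2"
  have "pochhammer a (Suc (Suc n)) = a * (a + real n + 1) * pochhammer (a + 1) n"
    by (subst pochhammer_rec, subst pochhammer_Suc) (simp add: algebra_simps)
  also have "\<dots> \<le> ?m\<^sup>2 * ?m ^ n"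
  proof (rule mult_mono)
    have "?m\<^sup>2 - a * (a + real n + 1) = ((real n + 1) / 2)\<^sup>2"
      by (simp add: power2_eq_square field_simps)
    then show "a * (a + real n + 1) \<le> ?m\<^sup>2" by (metis diff_ge_0_iff_ge zero_le_power2)
    have "a + 1 + (real n - 1) / 2 = ?m" by (simp add: field_simps)
    then show "pochhammer (a + 1) n \<le> ?m ^ n" using ge2(1)[of "a + 1"] ge2.prems by (metis add_increasing2 zero_le_one)
  qed (use ge2.prems in \<open>auto intro!: pochhammer_nonneg\<close>)
  also have "\<dots> = (a + (real (Suc (Suc n)) - 1) / 2) ^ Suc (Suc n)"
    by (simp add: power2_eq_square add.commute)
  finally show ?case .
qed auto

lemma fact_times_binomial_le:
  "fact n * real ((m + n) choose n) \<le> (real m + (real n + 1) / 2) ^ n"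
proof -
  have "fact n * fact m * real ((m + n) choose n) = fact (m + n)"
    using binomial_fact_lemma[of n "m + n"] by (metis add_diff_cancel_right' le_add2 of_nat_fact of_nat_mult)
  also have "\<dots> = fact m * pochhammer (real m + 1) n"
    by (simp add: pochhammer_fact pochhammer_product' add.commute)
  finally have "fact n * real ((m + n) choose n) = pochhammer (real m + 1) n" by simp
  also have "\<dots> \<le> (real m + 1 + (real n - 1) / 2) ^ n" by (intro pochhammer_le_power) simp
  also have "real m + 1 + (real n - 1) / 2 = real m + (real n + 1) / 2" by (simp add: field_simps)
  finally show ?thesis .
qed

text \<open>A single term of the expansion of \<open>(1 / 3 + 2 / 3) ^ (2 * r + n)\<close> is at
  most 1. The weights are in the ratio \<open>n : 2 * r\<close> for \<open>r = n\<close>, the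
  borderline case of \<open>radius_le_dim\<close>.\<close>

lemma binomial_le_thirds: "real ((2 * r + n) choose n) \<le> (9 / 4) ^ r * 3 ^ n"
proof -
  have "real ((2 * r + n) choose n) * (1 / 3) ^ n * (2 / 3) ^ (2 * r) \<le>
      (\<Sum>k\<le>2 * r + n. real ((2 * r + n) choose k) * (1 / 3) ^ k * (2 / 3) ^ (2 * r + n - k))"
    using member_le_sum[of n "{..2 * r + n}"
        "\<lambda>k. real ((2 * r + n) choose k) * (1 / 3) ^ k * (2 / 3) ^ (2 * r + n - k)"] by simp
  also have "\<dots> = (1 / 3 + 2 / 3) ^ (2 * r + n)" by (rule binomial_ring[symmetric])
  also have "\<dots> = 1" by simp
  finally have "real ((2 * r + n) choose n) * (1 / 3) ^ n * (4 / 9) ^ r \<le> 1"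
    by (simp add: power_mult power2_eq_square)
  then have "real ((2 * r + n) choose n) * (1 / 3) ^ n * (4 / 9) ^ r * ((9 / 4) ^ r * 3 ^ n)
      \<le> 1 * ((9 / 4) ^ r * 3 ^ n)"
    by (rule mult_right_mono) simp
  moreover have "real ((2 * r + n) choose n) * (1 / 3) ^ n * (4 / 9) ^ r * ((9 / 4) ^ r * 3 ^ n) =
      real ((2 * r + n) choose n) * ((1 / 3 * 3) ^ n * (4 / 9 * (9 / 4)) ^ r)"
    unfolding power_mult_distrib by (simp only: mult_ac)
  ultimately show ?thesis by simp
qed

section \<open>Comparison of the lower and upper bounds for the ball\<close>

text \<open>For \<open>r > n\<close> the binomial coefficient is at most
  \<open>(27 / 4) ^ r\<close>, which is less than \<open>7 ^ r\<close>; hence the threshold 7 for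
  \<open>q\<close>.\<close>

lemma radius_le_dim:
  assumes "q \<ge> 7" "q ^ Suc r \<le> (q - 1) * ((2 * r + n) choose n)"
  shows "r \<le> n"
proof (rule ccontr)
  assume "\<not> r \<le> n"
  have "(q - 1) * q ^ r \<le> q ^ Suc r" by simp
  with assms(2) have "(q - 1) * q ^ r \<le> (q - 1) * ((2 * r + n) choose n)" by linarith
  then have "q ^ r \<le> (2 * r + n) choose n" using assms(1) by simp
  moreover have "7 ^ r \<le> q ^ r" using assms(1) by (intro power_mono) auto
  ultimately have "7 ^ r \<le> (2 * r + n) choose n" by linarith
  then have "7 ^ r \<le> real ((2 * r + n) choose n)" by (metis of_nat_le_iff of_nat_numeral of_nat_power)
  also have "\<dots> \<le> (9 / 4) ^ r * 3 ^ n" by (rule binomial_le_thirds)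
  also have "\<dots> \<le> (9 / 4) ^ r * 3 ^ r"
    using \<open>\<not> r \<le> n\<close> by (intro mult_left_mono power_increasing) auto
  also have "\<dots> = (27 / 4) ^ r" by (simp flip: power_mult_distrib)
  also have "\<dots> < 7 ^ r" using \<open>\<not> r \<le> n\<close> by (intro power_strict_mono) auto
  finally show False by simp
qed

text \<open>The left side bounds \<open>q - 1\<close>. It grows by 2 per step, the right side by
  \<open>(6 / 5) ^ n\<close>, which is at least 2 from \<open>n = 4\<close> on.\<close>

lemma linear_le_power: "n \<ge> 4 \<Longrightarrow> 2 * real n - 2 \<le> 5 * (6 / 5) ^ n"
proof (induction n rule: dec_induct)
  case (step n)
  have "(6 / 5) ^ 4 \<le> (6 / 5 :: real) ^ n" using step by (intro power_increasing) auto
  then have "2 \<le> (6 / 5 :: real) ^ n" by (simp only: power4_eq_xxxx)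
  then show ?case using step by simp
qed (simp add: power_divide)

lemma degree_times_power_le:
  assumes "n \<ge> 2" "q \<ge> 2" "q + 1 \<le> 2 * n"
    and "q ^ Suc r \<le> (q - 1) * ((2 * r + n) choose n)"
  defines "x \<equiv> 2 * real r + (real n + 1) / 2" and "y \<equiv> 2 * real r + 2 + real n"
  shows "(real q - 1) * x ^ n * real n ^ n \<le> exp n * fact n * y ^ n"
proof (cases "q \<ge> 7")
  case False
  have "real n ^ n * (real q - 1) \<le> exp n * fact n"
  proof -
    consider "q \<le> 3" | "q \<le> 5" "n \<ge> 3" | "q = 6" "n \<ge> 4" using False assms(3) by linarith
    then show ?thesis
    proof cases
      case 1
      then have "real n ^ n * (real q - 1) \<le> real n ^ n * 2" by (intro mult_left_mono) auto
      also have "\<dots> \<le> exp n * fact n" using assms(1) by (rule pow_self_le_exp_fact)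
      finally show ?thesis .
    next
      case 2
      then have "real n ^ n * (real q - 1) \<le> real n ^ n * 4" by (intro mult_left_mono) auto
      also have "\<dots> \<le> exp n * fact n" using 2 by (intro pow_self_le_exp_fact)
      finally show ?thesis .
    next
      case 3
      then show ?thesis using pow_self_le_exp_fact(3)[of n] by simp
    qed
  qed
  moreover have "x ^ n \<le> y ^ n" by (intro power_mono) (auto simp: x_def y_def field_simps)
  ultimately have "real n ^ n * (real q - 1) * x ^ n \<le> exp n * fact n * y ^ n"
    by (rule mult_mono) (auto simp: x_def)
  then show ?thesis by (simp add: mult_ac)
next
  case True
  have n: "n \<ge> 4" using True assms(3) by linarith
  have "r \<le> n" using radius_le_dim[OF True assms(4)] .
  have "(real q - 1) * x ^ n \<le> 5 * (6 / 5) ^ n * x ^ n"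
    using linear_le_power[OF n] assms(3) by (intro mult_right_mono) (auto simp: x_def)
  also have "\<dots> = 5 * (6 / 5 * x) ^ n" by (simp add: power_mult_distrib power_divide)
  \<comment> \<open>Here \<open>6 / 5 * x \<le> y\<close> amounts to
    \<open>2 * r \<le> 2 * n + 7\<close>.\<close>
  also have "\<dots> \<le> 5 * y ^ n"
    using \<open>r \<le> n\<close> by (intro mult_left_mono power_mono) (auto simp: x_def y_def field_simps)
  finally have "(real q - 1) * x ^ n * real n ^ n \<le> 5 * y ^ n * real n ^ n"
    by (intro mult_right_mono) auto
  also have "\<dots> = real n ^ n * 5 * y ^ n" by simp
  also have "\<dots> \<le> exp n * fact n * y ^ n"
    using pow_self_le_exp_fact(3)[OF n] by (intro mult_right_mono) (auto simp: y_def)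
  finally show ?thesis .
qed

lemma power_Suc_le_exp:
  assumes "n \<ge> 2" "q \<ge> 2" "q + 1 \<le> 2 * n"
    and "r \<ge> 1 \<Longrightarrow> q ^ Suc r \<le> (q - 1) * ((2 * r + n) choose n)"
  shows "real q ^ Suc r \<le> (exp 1 * (2 * (real (Suc r) / real n) + 1)) ^ n"
proof (cases "r = 0")
  case True
  \<comment> \<open>For \<open>r = 0\<close> no ball estimate is assumed; the degree bound and
    Bernoulli's inequality, applied to both factors, suffice.\<close>
  have "real q \<le> 2 * real n" using assms(3) by linarith
  also have "\<dots> \<le> (1 + real n * 1) * (1 + real n * (2 / real n))" using assms(1) by (simp add: field_simps)
  also have "\<dots> \<le> (1 + 1) ^ n * (1 + 2 / real n) ^ n"
    by (intro mult_mono Bernoulli_inequality) (auto intro: order_trans[of _ 0])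
  also have "\<dots> \<le> exp 1 ^ n * (1 + 2 / real n) ^ n"
    using exp_1_ge by (intro mult_right_mono power_mono) auto
  finally show ?thesis using True by (simp add: power_mult_distrib add.commute)
next
  case False
  define x y where "x = 2 * real r + (real n + 1) / 2" and "y = 2 * real r + 2 + real n"
  have le: "q ^ Suc r \<le> (q - 1) * ((2 * r + n) choose n)" using assms(4) False by simp
  have "real q ^ Suc r = real (q ^ Suc r)" by simp
  also have "\<dots> \<le> real ((q - 1) * ((2 * r + n) choose n))" using le by (simp only: of_nat_le_iff)
  also have "\<dots> = (real q - 1) * real ((2 * r + n) choose n)" using assms(2) by simp
  finally have "fact n * real q ^ Suc r \<le> fact n * ((real q - 1) * real ((2 * r + n) choose n))"
    by (intro mult_left_mono) auto
  also have "\<dots> = (real q - 1) * (fact n * real ((2 * r + n) choose n))" by simp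
  also have "\<dots> \<le> (real q - 1) * x ^ n"
    using fact_times_binomial_le[of n "2 * r"] assms(2) by (intro mult_left_mono) (auto simp: x_def)
  finally have "fact n * real q ^ Suc r * real n ^ n \<le> (real q - 1) * x ^ n * real n ^ n"
    by (intro mult_right_mono) auto
  also have "\<dots> \<le> exp n * fact n * y ^ n"
    unfolding x_def y_def by (rule degree_times_power_le[OF assms(1-3) le])
  finally have "fact n * (real q ^ Suc r * real n ^ n) \<le> fact n * (exp n * y ^ n)"
    by (simp add: mult_ac)
  then have "real q ^ Suc r * real n ^ n \<le> exp n * y ^ n" by simp
  then have "real q ^ Suc r \<le> exp n * y ^ n / real n ^ n"
    using assms(1) by (simp add: pos_le_divide_eq)
  also have "\<dots> = (exp 1 * (y / real n)) ^ n"
    by (simp add: power_mult_distrib power_divide flip: exp_of_nat_mult)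
  also have "y / real n = 2 * (real (Suc r) / real n) + 1"
    using assms(1) by (simp add: y_def field_simps)
  finally show ?thesis .
qed

section \<open>The girth bound\<close>

theorem corollary1:
  fixes k :: nat and \<alpha> :: real and H :: "(int ^ 'n) pair_pre_digraph"
  assumes "k \<ge> 3" and "CARD('n) \<ge> 2"
    and "\<alpha> > 0" and "(real k - 1) powr \<alpha> > exp 1 * (2 * \<alpha> + 1)"
    and "subgraph (with_proj H) (with_proj grid)" and "symmetric (with_proj H)"
    and "regular k (with_proj H)"
  shows "ereal_of_enat (girth (with_proj H)) \<le> ereal (2 * \<alpha> * real CARD('n))"
proof (rule ccontr)
  assume large: "\<not> ereal_of_enat (girth (with_proj H)) \<le> ereal (2 * \<alpha> * real CARD('n))"
  define n where "n = CARD('n)"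
  define q where "q = k - 1"
  \<comment> \<open>Rounding down keeps \<open>2 * r\<close> below the length of every cycle, while
    \<open>Suc r / n\<close> exceeds \<alpha>, as \<open>threshold_mono\<close> requires.\<close>
  define r where "r = nat \<lfloor>\<alpha> * real n\<rfloor>"
  have q: "k = Suc q" "q \<ge> 2" and n: "n \<ge> 2" using assms(1,2) by (auto simp: q_def n_def)
  have r: "real r \<le> \<alpha> * real n" "\<alpha> * real n < real (Suc r)"
    using assms(3) by (auto simp: r_def) linarith
  have no_cycle: "2 * r < length c" if "pre_digraph.cycle (with_proj H) c" "3 \<le> length c" for c
  proof -
    have "girth (with_proj H) \<le> enat (length c)"
      unfolding girth_def using that by (intro INF_lower) auto
    then have "ereal_of_enat (girth (with_proj H)) \<le> ereal_of_enat (enat (length c))"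
      by (simp only: ereal_of_enat_le_iff)
    with large have "ereal (2 * \<alpha> * real n) < ereal (real (length c))"
      unfolding n_def not_le by (metis ereal_of_enat_simps(1) less_le_trans)
    then have "2 * (\<alpha> * real n) < real (length c)" by simp
    with r(1) have "real (2 * r) < real (length c)" by simp
    then show ?thesis by simp
  qed
  interpret grid: pair_loopfree_digraph "grid :: (int ^ 'n) pair_pre_digraph"
    by (rule pair_loopfree_digraph_grid)
  have sub: "parcs H \<subseteq> parcs grid" and wf: "pair_wf_digraph H"
    using assms(5) by (auto simp: subgraph_def wf_digraph_wp_iff)
  then have loopfree: "pair_loopfree_digraph H"
    unfolding pair_loopfree_digraph_def pair_loopfree_digraph_axioms_def
    by (blast dest: grid.pair_no_loops)
  have sym: "sym (parcs H)" using assms(6) by (simp add: symmetric_def)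
  have deg: "finite {w. (u, w) \<in> parcs H} \<and> card {w. (u, w) \<in> parcs H} = Suc q"
    if "u \<in> pverts H" for u
    using assms(7) that by (auto simp: regular_def q)
  obtain v where v: "v \<in> pverts H" using assms(7) by (auto simp: regular_def)
  have "Suc q \<le> card {w. (v, w) \<in> parcs grid}"
    using deg[OF v] sub card_mono[OF card_grid_neighbours_le(1)[of v], of "{w. (v, w) \<in> parcs H}"]
    by auto
  then have "q + 1 \<le> 2 * n" using card_grid_neighbours_le(2)[of v] by (simp add: n_def)
  moreover have "q ^ Suc r \<le> (q - 1) * ((2 * r + n) choose n)" if "r \<ge> 1"
  proof -
    have "q ^ Suc r \<le> (q - 1) * card {x. l1_dist x v \<le> int r}"
    proof (rule moore_bound[OF loopfree sym v deg no_cycle card_l1_dist_ball_le(1) _ q(2) that])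
      fix p assume "nonbacktracking (parcs H) p" "last p = v" "length p \<le> Suc r"
      then show "hd p \<in> {x. l1_dist x v \<le> int r}"
        using l1_dist_nonbacktracking[OF sub, of p] by simp
    qed
    also have "\<dots> \<le> (q - 1) * ((2 * r + n) choose n)"
      unfolding n_def by (intro mult_left_mono card_l1_dist_ball_le) simp
    finally show ?thesis .
  qed
  ultimately have "real q ^ Suc r \<le> (exp 1 * (2 * (real (Suc r) / real n) + 1)) ^ n"
    by (rule power_Suc_le_exp[OF n q(2)])
  \<comment> \<open>The n-th power of the threshold inequality at \<open>Suc r / n\<close> has
    \<open>q ^ Suc r\<close> on its right, so the chain returns strictly to its start.\<close>
  also have "\<dots> < (real q powr (real (Suc r) / real n)) ^ n"
  proof (rule power_strict_mono)
    have "\<alpha> \<le> real (Suc r) / real n" using n r(2) by (simp add: pos_le_divide_eq)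
    moreover have "exp 1 * (2 * \<alpha> + 1) < real q powr \<alpha>" using assms(4) by (simp add: q)
    ultimately show "exp 1 * (2 * (real (Suc r) / real n) + 1) < real q powr (real (Suc r) / real n)"
      using assms(3) q(2) by (subst threshold_mono[of _ \<alpha>]) simp_all
  qed (use n in auto)
  also have "\<dots> = (real q powr (real (Suc r) / real n)) powr real n"
    using q(2) by (intro powr_realpow[symmetric]) simp
  also have "\<dots> = real q powr real (Suc r)" using n by (simp add: powr_powr)
  also have "\<dots> = real q ^ Suc r" using q(2) by (intro powr_realpow) simp
  finally show False by simp
qed

end
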